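(* For $n \geq 6$, let $T_n$ be the tree of order $n$ obtained from a path on $5$ vertices by attaching $n-5$ new leaves to the middle (third) vertex of the path. Then $T_n$ has a real Wiener root in the open interval $\left(-\left( 1 + \tfrac{1}{\sqrt{2}}\right)n+7,\; -\left( 1 + \tfrac{1}{\sqrt{2}}\right)n + 8\right)$.
   Context: For a connected graph $G$ of order at least $2$, the Wiener polynomial is $W(G;x)=\sum x^{d(u,v)}$, where $d(u,v)$ is the distance between $u$ and $v$ and the sum ranges over all unordered pairs of distinct vertices. A Wiener root of $G$ is a complex root of $W(G;x)$. *)

theory Defs
  imports Complex_Main
    "HOL-Computational_Algebra.Polynomial"
    "Graph_Theory.Pair_Digraph"
    "Graph_Theory.Digraph_Component"
begin

text \<open>
  A finite simple graph is a \<^locale>\<open>pair_graph\<close>: every edge \<open>uv\<close> is represented by the two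
  arcs \<open>(u, v)\<close> and \<open>(v, u)\<close>.
\<close>

definition gdist :: "'a pair_pre_digraph \<Rightarrow> 'a \<Rightarrow> 'a \<Rightarrow> nat" where
  "gdist G u v = (LEAST k. \<exists>p. pre_digraph.awalk (with_proj G) u p v \<and> length p = k)"

text \<open>
  The distance of an unordered pair; well defined because \<^const>\<open>gdist\<close> is symmetric on
  undirected graphs (lemma \<open>pair_dist_doubleton\<close> below).
\<close>

definition pair_dist :: "'a pair_pre_digraph \<Rightarrow> 'a set \<Rightarrow> nat" where
  "pair_dist G e = (THE d. \<exists>u v. e = {u, v} \<and> d = gdist G u v)"

text \<open>Meaningful for connected graphs only, as \<^const>\<open>gdist\<close> is.\<close>

definition wiener_poly :: "'a pair_pre_digraph \<Rightarrow> complex poly" where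
  "wiener_poly G = (\<Sum>e \<in> {e. e \<subseteq> pverts G \<and> card e = 2}. monom 1 (pair_dist G e))"

definition wiener_root :: "'a pair_pre_digraph \<Rightarrow> complex \<Rightarrow> bool" where
  "wiener_root G z \<longleftrightarrow> poly (wiener_poly G) z = 0"

definition path_graph :: "nat \<Rightarrow> nat pair_pre_digraph" where
  "path_graph m = \<lparr>pverts = {..<m},
     parcs = {(i, j). i < m \<and> j < m \<and> (j = Suc i \<or> i = Suc j)}\<rparr>"

definition attach_leaves :: "'a pair_pre_digraph \<Rightarrow> 'a \<Rightarrow> 'a set \<Rightarrow> 'a pair_pre_digraph" where
  "attach_leaves G c L = \<lparr>pverts = pverts G \<union> L, parcs = parcs G \<union> {c} \<times> L \<union> L \<times> {c}\<rparr>"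

text \<open>The path is \<open>0 - 1 - 2 - 3 - 4\<close>, with middle vertex \<open>2\<close>; the new leaves are \<open>5, \<dots>, n - 1\<close>.\<close>

definition tree_T :: "nat \<Rightarrow> nat pair_pre_digraph" where
  "tree_T n = attach_leaves (path_graph 5) 2 {5..<n}"

lemma awalk_reverse:
  assumes "pair_sym_digraph G" "pre_digraph.awalk (with_proj G) u p v"
  shows "\<exists>q. pre_digraph.awalk (with_proj G) v q u \<and> length q = length p"
proof -
  interpret pair_sym_digraph G by fact
  from assms(2) show ?thesis
  proof (induction p arbitrary: u)
    case Nil
    then show ?case by (intro exI[of _ "[]"]) (auto simp: awalk_Nil_iff)
  next
    case (Cons e p)
    then have e: "e \<in> parcs G" "fst e = u" "awalk (snd e) p v"
      by (auto simp: awalk_Cons_iff)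
    then obtain q where q: "awalk v q (snd e)" "length q = length p"
      using Cons.IH by blast
    have "(snd e, u) \<in> parcs G"
      using e(1,2) pair_sym_arcs
      by (metis prod.collapse symD symmetric_def with_proj_simps(3))
    moreover from this have "awalk (snd e) [(snd e, u)] u"
      by (auto simp: awalk_Cons_iff awalk_Nil_iff in_arcsD1 in_arcsD2)
    ultimately show ?case
      using q by (intro exI[of _ "q @ [(snd e, u)]"]) auto
  qed
qed

lemma gdist_commute:
  assumes "pair_sym_digraph G"
  shows "gdist G u v = gdist G v u"
proof -
  have "(\<lambda>k. \<exists>p. pre_digraph.awalk (with_proj G) u p v \<and> length p = k) =
        (\<lambda>k. \<exists>p. pre_digraph.awalk (with_proj G) v p u \<and> length p = k)"
    using awalk_reverse[OF assms] by metis
  then show ?thesis by (simp add: gdist_def)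
qed

lemma pair_dist_doubleton:
  assumes "pair_sym_digraph G"
  shows "pair_dist G {u, v} = gdist G u v"
  unfolding pair_dist_def
  by (rule the_equality) (auto simp: doubleton_eq_iff gdist_commute[OF assms])

lemma pverts_tree_T: "n \<ge> 5 \<Longrightarrow> pverts (tree_T n) = {..<n}"
  by (auto simp: tree_T_def attach_leaves_def path_graph_def)

lemma parcs_tree_T_iff:
  "(u, v) \<in> parcs (tree_T n) \<longleftrightarrow> u < 5 \<and> v < 5 \<and> (v = Suc u \<or> u = Suc v)
     \<or> u = 2 \<and> 5 \<le> v \<and> v < n \<or> v = 2 \<and> 5 \<le> u \<and> u < n"
  by (auto simp: tree_T_def attach_leaves_def path_graph_def)

lemma pair_graph_tree_T: "pair_graph (tree_T n)"
proof unfold_locales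
  have "parcs (tree_T n) \<subseteq> pverts (tree_T n) \<times> pverts (tree_T n)"
    by (auto simp: tree_T_def attach_leaves_def path_graph_def)
  moreover show fin: "finite (pverts (tree_T n))"
    by (auto simp: tree_T_def attach_leaves_def path_graph_def)
  ultimately show "finite (parcs (tree_T n))"
    by (meson finite_SigmaI finite_subset)
qed (auto simp: tree_T_def attach_leaves_def path_graph_def symmetric_def intro!: symI)

text \<open>\<^term>\<open>tree_T n\<close> is connected with \<open>n\<close> vertices and \<open>n - 1\<close> edges, hence a tree.\<close>

lemma strongly_connected_tree_T: "strongly_connected (with_proj (tree_T n))"
proof -
  interpret pair_graph "tree_T n" by (rule pair_graph_tree_T)
  have two: "2 \<in> pverts (tree_T n)"
    by (simp add: tree_T_def attach_leaves_def path_graph_def)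
  have arc: "u \<rightarrow>\<^sup>*\<^bsub>with_proj (tree_T n)\<^esub> v" if "(u, v) \<in> parcs (tree_T n)" for u v
    using that by (intro reachable_adjI) auto
  have to2: "u \<rightarrow>\<^sup>*\<^bsub>with_proj (tree_T n)\<^esub> 2" if u: "u \<in> pverts (tree_T n)" for u
  proof -
    consider "u = 0" | "u = 4" | "u = 2" | "(u, 2) \<in> parcs (tree_T n)"
    proof -
      have "u < 5 \<or> 5 \<le> u \<and> u < n"
        using u by (auto simp: tree_T_def attach_leaves_def path_graph_def)
      then have "u = 0 \<or> u = 4 \<or> u = 2 \<or> u = 1 \<or> u = 3 \<or> 5 \<le> u \<and> u < n"
        by linarith
      then show thesis
        using that by (auto simp: parcs_tree_T_iff)
    qed
    then show ?thesis
    proof cases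
      case 1
      have "(0, 1) \<in> parcs (tree_T n)" "(1, 2) \<in> parcs (tree_T n)"
        by (auto simp: parcs_tree_T_iff)
      then show ?thesis using 1 reachable_trans[OF arc arc] by blast
    next
      case 2
      have "(4, 3) \<in> parcs (tree_T n)" "(3, 2) \<in> parcs (tree_T n)"
        by (auto simp: parcs_tree_T_iff)
      then show ?thesis using 2 reachable_trans[OF arc arc] by blast
    qed (use two arc in auto)
  qed
  then have "2 \<rightarrow>\<^sup>*\<^bsub>with_proj (tree_T n)\<^esub> u" if "u \<in> pverts (tree_T n)" for u
    using that symmetric_reachable[OF sym_arcs] by blast
  with to2 show ?thesis
    unfolding strongly_connected_def with_proj_simps(1)
    using two reachable_trans by blast
qed

lemma card_tree_T:
  assumes "n \<ge> 5"
  shows "card (pverts (tree_T n)) = n" "card (parcs (tree_T n)) = 2 * (n - 1)"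
proof -
  show "card (pverts (tree_T n)) = n"
    using assms by (simp add: pverts_tree_T)
  have P: "parcs (path_graph 5) = {(0,1),(1,0),(1,2),(2,1),(2,3),(3,2),(3,4),(4,3)}"
  proof (intro equalityI subrelI)
    fix i j assume "(i, j) \<in> parcs (path_graph 5)"
    then have "i < 5" "j = Suc i \<and> i < 4 \<or> i = Suc j"
      by (auto simp: path_graph_def)
    then have "i = 0 \<and> j = 1 \<or> i = 1 \<and> j = 0 \<or> i = 1 \<and> j = 2 \<or> i = 2 \<and> j = 1 \<or>
        i = 2 \<and> j = 3 \<or> i = 3 \<and> j = 2 \<or> i = 3 \<and> j = 4 \<or> i = 4 \<and> j = 3"
      by presburger
    then show "(i, j) \<in> {(0,1),(1,0),(1,2),(2,1),(2,3),(3,2),(3,4),(4,3)}"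
      by blast
  qed (auto simp: path_graph_def)
  have "parcs (tree_T n) = parcs (path_graph 5) \<union> ({2} \<times> {5..<n} \<union> {5..<n} \<times> {2})"
    by (auto simp: tree_T_def attach_leaves_def)
  moreover have "card ({2} \<times> {5..<n} \<union> {5..<n} \<times> {2}) = 2 * (n - 5)"
    by (subst card_Un_disjoint) (auto simp: card_cartesian_product)
  moreover have "card (parcs (path_graph 5)) = 8"
    unfolding P by simp
  moreover have "parcs (path_graph 5) \<inter> ({2} \<times> {5..<n} \<union> {5..<n} \<times> {2}) = {}"
    unfolding P by auto
  moreover have "finite (parcs (path_graph 5))"
    unfolding P by simp
  ultimately show "card (parcs (tree_T n)) = 2 * (n - 1)"
    using assms by (simp add: card_Un_disjoint)
qed

end

theory Submission
  imports Defs
begin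

text \<open>
  Counting pairs of vertices by distance gives
  \<open>2 W(T\<^sub>n; x) = x (2 x\<^sup>3 + 4 (n - 4) x\<^sup>2 + (n\<^sup>2 - 7 n + 16) x + 2 (n - 1))\<close>.
  Put \<open>c = 1 + 1 / \<surd>2\<close>, the larger root of \<open>c\<^sup>2 = 2 c - 1/2\<close>. At \<open>x = - c n + t\<close> the \<open>n\<^sup>3\<close> term
  of the cubic factor vanishes, and what remains is a quadratic in \<open>n\<close> that is negative for
  \<open>t = 7\<close> and positive for \<open>t = 8\<close>, so the intermediate value theorem applies.
\<close>

text \<open>A potential certifies the distance: by \<open>step\<close>, each arc lowers
  \<open>f\<close> by at most one, so every walk to \<open>v\<close> has length at least
  \<open>f u\<close>; following \<open>descent\<close> until \<open>f\<close> reaches 0 gives a walk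
  attaining this bound.\<close>

lemma gdist_eqI:
  assumes G: "pair_graph G"
    and v: "v \<in> pverts G" "f v = 0"
    and step: "\<And>u w. (u, w) \<in> parcs G \<Longrightarrow> f u \<le> Suc (f w)"
    and descent: "\<And>u. u \<in> pverts G \<Longrightarrow> u \<noteq> v \<Longrightarrow> \<exists>w. (u, w) \<in> parcs G \<and> f u = Suc (f w)"
    and u: "u \<in> pverts G"
  shows "gdist G u v = f u"
proof -
  interpret pair_graph G by (rule G)
  have lower: "f u \<le> length p" if "awalk u p v" for u p
    using that
  proof (induction p arbitrary: u)
    case Nil
    then show ?case by (simp add: awalk_Nil_iff v)
  next
    case (Cons e p)
    then have "e \<in> parcs G" "fst e = u" "awalk (snd e) p v"
      by (auto simp: awalk_Cons_iff)
    then show ?case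
      using Cons.IH[of "snd e"] step[of u "snd e"] by (cases e) auto
  qed
  have upper: "\<exists>p. awalk u p v \<and> length p = f u" if "u \<in> pverts G" for u
    using that
  proof (induction "f u" arbitrary: u rule: less_induct)
    case less
    show ?case
    proof (cases "u = v")
      case True
      then show ?thesis using v by (auto simp: awalk_Nil_iff)
    next
      case False
      then obtain w where w: "(u, w) \<in> parcs G" "f u = Suc (f w)"
        using descent less.prems by blast
      then have "w \<in> pverts G" by (simp add: in_arcsD2)
      then obtain p where "awalk w p v" "length p = f w"
        using less.hyps[of w] w by auto
      then show ?thesis
        using w less.prems by (intro exI[of _ "(u, w) # p"]) (auto simp: awalk_Cons_iff)
    qed
  qed
  show ?thesis
    unfolding gdist_def
    by (rule Least_equality) (use lower upper[OF u] in auto)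
qed

text \<open>Sorting pairs by their larger element lets a new vertex contribute one separate inner
  sum, which suits induction on the order of the tree.\<close>

lemma sum_pairs_lessThan:
  fixes g :: "nat set \<Rightarrow> 'b::comm_monoid_add"
  shows "(\<Sum>e | e \<subseteq> {..<n} \<and> card e = 2. g e) = (\<Sum>v<n. \<Sum>u<v. g {u, v})"
proof (induction n)
  case 0
  have empty: "{e :: nat set. e \<subseteq> {..<0} \<and> card e = 2} = {}" by auto
  show ?case unfolding empty by simp
next
  case (Suc n)
  have split: "{e. e \<subseteq> {..<Suc n} \<and> card e = 2} =
      {e. e \<subseteq> {..<n} \<and> card e = 2} \<union> (\<lambda>u. {u, n}) ` {..<n}" (is "?A = ?B \<union> ?C")
  proof
    show "?A \<subseteq> ?B \<union> ?C"
    proof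
      fix e assume e: "e \<in> ?A"
      then obtain a b where ab: "e = {a, b}" "a \<noteq> b" by (auto simp: card_2_iff)
      then consider "a < n" "b < n" | "a < n" "b = n" | "a = n" "b < n"
        using e by (auto simp: less_Suc_eq)
      then show "e \<in> ?B \<union> ?C"
        using ab by cases (auto simp: insert_commute)
    qed
    show "?B \<union> ?C \<subseteq> ?A" by (auto simp: card_2_iff)
  qed
  have "inj_on (\<lambda>u. {u, n}) {..<n}"
    by (auto simp: inj_on_def doubleton_eq_iff)
  moreover have "finite ?B"
    by (rule finite_subset[of _ "Pow {..<n}"]) auto
  ultimately show ?case
    unfolding split using Suc
    by (subst sum.union_disjoint) (auto simp: sum.reindex)
qed

text \<open>Depth in the tree rooted at the middle vertex 2.\<close>

definition tree_T_height :: "nat \<Rightarrow> nat" where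
  "tree_T_height u = (if u = 2 then 0 else if u = 0 \<or> u = 4 then 2 else 1)"

text \<open>A path between distinct vertices passes through the root unless both lie in one branch,
  and only the branches {0, 1} and {3, 4} have two vertices. The formula does not mention
  \<open>n\<close>, so adding a leaf keeps all old distances.\<close>

definition tree_T_dist :: "nat \<Rightarrow> nat \<Rightarrow> nat" where
  "tree_T_dist u v =
     (if u = v then 0
      else if {u, v} = {0, 1} \<or> {u, v} = {3, 4} then 1
      else tree_T_height u + tree_T_height v)"

lemma gdist_tree_T:
  assumes n: "n \<ge> 5" and u: "u < n" and v: "v < n"
  shows "gdist (tree_T n) u v = tree_T_dist u v"
proof (rule gdist_eqI[where f = "\<lambda>u. tree_T_dist u v"])
  show "pair_graph (tree_T n)" by (rule pair_graph_tree_T)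
  show "tree_T_dist a v \<le> Suc (tree_T_dist b v)" if "(a, b) \<in> parcs (tree_T n)" for a b
  proof -
    have "a = 0 \<and> b = 1 \<or> a = 1 \<and> b = 0 \<or> a = 1 \<and> b = 2 \<or> a = 2 \<and> b = 1 \<or>
        a = 2 \<and> b = 3 \<or> a = 3 \<and> b = 2 \<or> a = 3 \<and> b = 4 \<or> a = 4 \<and> b = 3 \<or>
        a = 2 \<and> 5 \<le> b \<or> b = 2 \<and> 5 \<le> a"
      using that unfolding parcs_tree_T_iff by presburger
    then show ?thesis
      by (elim disjE)
        (auto simp: tree_T_dist_def tree_T_height_def doubleton_eq_iff)
  qed
  show "\<exists>w. (a, w) \<in> parcs (tree_T n) \<and> tree_T_dist a v = Suc (tree_T_dist w v)"
    if "a \<in> pverts (tree_T n)" "a \<noteq> v" for a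
  proof -
    \<comment> \<open>The next vertex on the path from \<open>a\<close> to \<open>v\<close>: the
      ends 0 and 4 have a single neighbour, the centre moves into the branch of \<open>v\<close>,
      and 1 or 3 moves outward only when \<open>v\<close> is the adjacent end. All other vertices
      move to the centre.\<close>
    define w where "w =
      (if a = 0 then 1 else if a = 4 then 3
       else if a = 2 then (if v = 0 then 1 else if v = 4 then 3 else v)
       else if a = 1 \<and> v = 0 then 0 else if a = 3 \<and> v = 4 then 4 else 2)"
    have a: "a < n" using that n by (simp add: pverts_tree_T)
    have "a = 0 \<or> a = 1 \<or> a = 2 \<or> a = 3 \<or> a = 4 \<or> 5 \<le> a" by linarith
    moreover have "v = 0 \<or> v = 1 \<or> v = 2 \<or> v = 3 \<or> v = 4 \<or> 5 \<le> v" by linarith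
    ultimately have "(a, w) \<in> parcs (tree_T n) \<and> tree_T_dist a v = Suc (tree_T_dist w v)"
      using a v \<open>a \<noteq> v\<close>
      by (elim disjE)
        (simp_all add: w_def parcs_tree_T_iff tree_T_dist_def tree_T_height_def doubleton_eq_iff)
    then show ?thesis ..
  qed
qed (use assms in \<open>auto simp: pverts_tree_T tree_T_dist_def\<close>)

lemma poly_wiener_tree_T:
  assumes n: "n \<ge> 5"
  shows "poly (wiener_poly (tree_T n)) z = (\<Sum>v<n. \<Sum>u<v. z ^ tree_T_dist u v)"
proof -
  interpret pair_graph "tree_T n" by (rule pair_graph_tree_T)
  have "pair_dist (tree_T n) {u, v} = tree_T_dist u v" if "v < n" "u < v" for u v
    using that n by (simp add: pair_dist_doubleton[OF pair_sym_digraph_axioms] gdist_tree_T)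
  then show ?thesis
    using n by (simp add: wiener_poly_def pverts_tree_T sum_pairs_lessThan poly_sum poly_monom)
qed

text \<open>The increment when \<open>n\<close> joins as a new leaf: it is at distance 1 from the
  centre, 2 from 1, 3 and the \<open>n - 5\<close> older leaves, and 3 from 0 and 4.\<close>

lemma sum_tree_T_dist_leaf:
  fixes z :: "'a::comm_ring_1"
  assumes "n \<ge> 5"
  shows "(\<Sum>u<n. z ^ tree_T_dist u n) = z + (of_nat n - 3) * z ^ 2 + 2 * z ^ 3"
proof -
  have "{..<n} = {0, 1, 2, 3, 4} \<union> {5..<n}" using assms by auto
  then have "(\<Sum>u<n. z ^ tree_T_dist u n) =
      (\<Sum>u\<in>{0, 1, 2, 3, 4}. z ^ tree_T_dist u n) + (\<Sum>u=5..<n. z ^ tree_T_dist u n)"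
    by (simp add: sum.union_disjoint)
  also have "(\<Sum>u=5..<n. z ^ tree_T_dist u n) = (\<Sum>u=5..<n. z ^ 2)"
    by (rule sum.cong)
      (use assms in \<open>auto simp: tree_T_dist_def tree_T_height_def doubleton_eq_iff power2_eq_square\<close>)
  also have "\<dots> = (of_nat n - 5) * z ^ 2"
    using assms by (simp add: of_nat_diff)
  also have "(\<Sum>u\<in>{0, 1, 2, 3, 4}. z ^ tree_T_dist u n) = z + 2 * z ^ 2 + 2 * z ^ 3"
    using assms
    by (simp add: tree_T_dist_def tree_T_height_def doubleton_eq_iff
        numeral_2_eq_2 numeral_3_eq_3)
  finally show ?thesis by (simp add: algebra_simps)
qed

text \<open>Induction from the path of order 5, each new leaf adding the sum above. The factor 2
  clears the denominator of the quadratic count of pairs at distance 2.\<close>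

lemma poly_wiener_tree_T_closed:
  assumes "n \<ge> 5"
  shows "2 * poly (wiener_poly (tree_T n)) z =
    z * (2 * z ^ 3 + 4 * (of_nat n - 4) * z ^ 2 + (of_nat n ^ 2 - 7 * of_nat n + 16) * z
      + 2 * (of_nat n - 1))"
  unfolding poly_wiener_tree_T[OF assms]
  using assms
proof (induction n rule: nat_induct_at_least)
  case base
  have "{..<5::nat} = {0, 1, 2, 3, 4}" "{..<4::nat} = {0, 1, 2, 3}" "{..<3::nat} = {0, 1, 2}"
    "{..<2::nat} = {0, 1}" "{..<1::nat} = {0}"
    by auto
  then show ?case
    by (simp add: tree_T_dist_def tree_T_height_def doubleton_eq_iff algebra_simps
        power2_eq_square power3_eq_cube power4_eq_xxxx)
next
  case (Suc n)
  then show ?case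
    by (simp add: sum_tree_T_dist_leaf distrib_left)
      (simp add: algebra_simps power2_eq_square power3_eq_cube)
qed

theorem theorem6:
  fixes n :: nat
  assumes "n \<ge> 6"
  shows "\<exists>x::real. x \<in> {- (1 + 1 / sqrt 2) * real n + 7 <..< - (1 + 1 / sqrt 2) * real n + 8}
           \<and> wiener_root (tree_T n) (complex_of_real x)"
proof -
  define c where "c = 1 + 1 / sqrt (2::real)"
  define m where "m = real n"
  define f where "f x = 2 * x ^ 3 + 4 * (m - 4) * x ^ 2 + (m ^ 2 - 7 * m + 16) * x + 2 * (m - 1)"
    for x :: real
  have m: "m \<ge> 6" using assms by (simp add: m_def)
  have c2: "c ^ 2 = 2 * c - 1 / 2"
    by (simp add: c_def power2_eq_square field_simps)
  have c3: "c ^ 3 = 7 / 2 * c - 1"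
  proof -
    have "c ^ 3 = c * c ^ 2" by (simp add: power2_eq_square power3_eq_cube)
    also have "\<dots> = c * (2 * c - 1 / 2)" by (simp only: c2)
    also have "\<dots> = 2 * c ^ 2 - c / 2" by (simp add: power2_eq_square algebra_simps)
    finally show ?thesis using c2 by simp
  qed
  have "c > 1" by (simp add: c_def)
  \<comment> \<open>Both decimal bounds compare squares, since \<open>c2\<close> says that
    \<open>(c - 1) ^ 2 = 1 / 2\<close>.\<close>
  have c_lower: "c > 1707 / 1000"
  proof (rule ccontr)
    assume "\<not> c > 1707 / 1000"
    then have "(c - 1) ^ 2 \<le> (707 / 1000) ^ 2" using \<open>c > 1\<close> by (intro power_mono) auto
    then show False using c2 by (simp add: power2_eq_square algebra_simps)
  qed
  have c_upper: "c < 1708 / 1000"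
  proof (rule ccontr)
    assume "\<not> c < 1708 / 1000"
    then have "(708 / 1000) ^ 2 \<le> (c - 1) ^ 2" by (intro power_mono) auto
    then show False using c2 by (simp add: power2_eq_square algebra_simps)
  qed
  have expand: "f (- c * m + t) =
      2 * (((2 * c - 1) * t - 25 / 2 * c + 4) * m ^ 2
        + ((2 - 3 * c) * t ^ 2 + (16 * c - 7 / 2) * t - 8 * c + 1) * m
        + (t ^ 3 - 8 * t ^ 2 + 8 * t - 1))" for t
  proof -
    \<comment> \<open>Here the coefficient of \<open>m ^ 3\<close> is
      \<open>- c * (c ^ 2 - 2 * c + 1 / 2)\<close>, which is 0 by \<open>c2\<close>;
      \<open>c2\<close> and \<open>c3\<close> make the other coefficients linear in
      \<open>c\<close>.\<close>
    have "f (- c * m + t) =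
      2 * ((- (c ^ 3) + 2 * c ^ 2 - c / 2) * m ^ 3
        + ((3 * c ^ 2 - 4 * c + 1 / 2) * t - 8 * c ^ 2 + 7 / 2 * c) * m ^ 2
        + ((2 - 3 * c) * t ^ 2 + (16 * c - 7 / 2) * t - 8 * c + 1) * m
        + (t ^ 3 - 8 * t ^ 2 + 8 * t - 1))"
      by (simp add: f_def power2_eq_square power3_eq_cube field_simps)
    then show ?thesis by (simp add: c2 c3 algebra_simps)
  qed
  have neg: "f (- c * m + 7) < 0"
  proof -
    have "f (- c * m + 7) = 2 * ((3 / 2 * c - 3) * m ^ 2 + (149 / 2 - 43 * c) * m + 6)"
      unfolding expand by (simp add: algebra_simps)
    \<comment> \<open>The upper bound on \<open>c\<close> controls the coefficient of
      \<open>m ^ 2\<close>, the lower bound that of \<open>m\<close>.\<close>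
    moreover have "(3 / 2 * c - 3) * m ^ 2 + (149 / 2 - 43 * c) * m + 6
        \<le> - (438 / 1000) * m ^ 2 + 1099 / 1000 * m + 6"
      using c_lower c_upper m by (intro add_mono mult_right_mono) auto
    moreover have "m ^ 2 \<ge> 6 * m" using m by (simp add: power2_eq_square)
    then have "- (438 / 1000) * m ^ 2 + 1099 / 1000 * m + 6 < 0" using m by simp
    ultimately show ?thesis by simp
  qed
  have pos: "0 < f (- c * m + 8)"
  proof -
    have "f (- c * m + 8) = 2 * ((7 / 2 * c - 4) * m ^ 2 + (101 - 72 * c) * m + 63)"
      unfolding expand by (simp add: algebra_simps)
    moreover have "1974 / 1000 * m ^ 2 + - (21976 / 1000) * m + 63
        \<le> (7 / 2 * c - 4) * m ^ 2 + (101 - 72 * c) * m + 63"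
      using c_lower c_upper m by (intro add_mono mult_right_mono) auto
    \<comment> \<open>The quadratic lower bound is smallest near \<open>m = 5.57\<close>. Replacing
      \<open>m ^ 2\<close> by its tangent there leaves a linear expression with positive
      coefficients.\<close>
    moreover have "0 \<le> (m - 557 / 100) ^ 2" by simp
    then have "m ^ 2 \<ge> 1114 / 100 * m - 310249 / 10000"
      by (simp add: power2_eq_square algebra_simps)
    then have "0 < 1974 / 1000 * m ^ 2 + - (21976 / 1000) * m + 63" using m by simp
    ultimately show ?thesis by simp
  qed
  have "continuous_on {- c * m + 7..- c * m + 8} f"
    unfolding f_def by (intro continuous_intros)
  then obtain x where x: "- c * m + 7 \<le> x" "x \<le> - c * m + 8" "f x = 0"
    using IVT'[of f "- c * m + 7" 0 "- c * m + 8"] neg pos by auto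
  have "x \<noteq> - c * m + 7" "x \<noteq> - c * m + 8" using x neg pos by auto
  with x have "x \<in> {- c * m + 7 <..< - c * m + 8}" by auto
  moreover have "2 * poly (wiener_poly (tree_T n)) (complex_of_real x) = complex_of_real (x * f x)"
    using assms by (simp add: poly_wiener_tree_T_closed f_def m_def)
  then have "wiener_root (tree_T n) (complex_of_real x)"
    by (simp add: wiener_root_def x)
  ultimately show ?thesis
    unfolding c_def m_def by blast
qed

end
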